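(* For every integer $n \ge 1$, \[ n \cdot \widetilde{F}_{n,n} = \widetilde{M}_{n,n}. \]
   Context: $[n]=\{1,\dots,n\}$. Parking process: given $0\le m\le n$, a sequence $s\in[n]^m$ and a digraph $D$ with vertex set $[n]$ (loops allowed), drivers $1,\dots,m$ attempt to park one by one, in this order. Driver $i$ begins at vertex $s_i$. If the current vertex is unoccupied, the driver parks there; if it is occupied, the driver chooses an out-neighbor of the current vertex and drives there, and repeats this until she parks (and then the next driver enters) or is unable to find an available spot (and then the process terminates). Thus each driver follows a directed walk of her choice starting at $s_i$ and parks at the first unoccupied vertex on it. The sequence $s$ is a parking function on $D$ if it is possible (for some choices of the drivers) for all $m$ drivers to park. Let $P(D,m)$ be the number of $s\in[n]^m$ that are parking functions on $D$. $\widetilde{\mathcal{T}}_n$ is the set of all source trees on vertex set $[n]$: rooted (labeled) trees with vertex set $[n]$ with all edges oriented away from the root. For $f:[n]\to[n]$, the inverse mapping digraph $\widetilde{M}_f$ has vertex set $[n]$ and edge set $\{(f(i),i) : i\in[n]\}$ (the edge $(a,b)$ is directed from $a$ to $b$; loops allowed). $\widetilde{\mathcal{M}}_n$ is the set of all $\widetilde{M}_f$ with $f:[n]\to[n]$. Define \[ \widetilde{F}_{n,m}=\sum_{\widetilde{T}\in\widetilde{\mathcal{T}}_n}P(\widetilde{T},m),\qquad \widetilde{M}_{n,m}=\sum_{\widetilde{M}\in\widetilde{\mathcal{M}}_n}P(\widetilde{M},m). \] *)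

theory Defs
  imports "Graph_Theory.Digraph_Component"
begin

section \<open>Parking on digraphs\<close>

text \<open>
  Digraphs (loops allowed, no parallel arcs) are rendered as \<^typ>\<open>nat pair_pre_digraph\<close>.
  \<open>driver_parks D Occ u v\<close>: when \<open>Occ\<close> is the set of occupied vertices, a driver currently
  at \<open>u\<close> can, for some choice of her out-neighbours, end up parking at \<open>v\<close>.
\<close>

inductive driver_parks :: "'a pair_pre_digraph \<Rightarrow> 'a set \<Rightarrow> 'a \<Rightarrow> 'a \<Rightarrow> bool"
  for D :: "'a pair_pre_digraph" and Occ :: "'a set" where
  park: "u \<in> pverts D \<Longrightarrow> u \<notin> Occ \<Longrightarrow> driver_parks D Occ u u"
| drive: "u \<in> Occ \<Longrightarrow> (u, w) \<in> parcs D \<Longrightarrow> driver_parks D Occ w v \<Longrightarrow> driver_parks D Occ u v"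

inductive drivers_park :: "'a pair_pre_digraph \<Rightarrow> 'a set \<Rightarrow> 'a list \<Rightarrow> bool"
  for D :: "'a pair_pre_digraph" where
  no_driver: "drivers_park D Occ []"
| next_driver: "driver_parks D Occ u v \<Longrightarrow> drivers_park D (insert v Occ) s
    \<Longrightarrow> drivers_park D Occ (u # s)"

definition parking_function :: "'a pair_pre_digraph \<Rightarrow> 'a list \<Rightarrow> bool" where
  "parking_function D s \<longleftrightarrow> set s \<subseteq> pverts D \<and> drivers_park D {} s"

definition num_parking_functions :: "'a pair_pre_digraph \<Rightarrow> nat \<Rightarrow> nat" where
  "num_parking_functions D m = card {s. length s = m \<and> parking_function D s}"


section \<open>Source trees and inverse mapping digraphs\<close>

text \<open>
  A simple graph is a \<^const>\<open>pair_graph\<close>, i.e. a finite loopfree symmetric digraph. In it,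
  traversing an edge back and forth counts as a \<^const>\<open>pre_digraph.cycle\<close> of length 2, so
  acyclicity means that there is no cycle of length at least 3. (The library's \<open>tree\<close> forbids
  directed cycles of every length, so it is the wrong notion here.)
\<close>

definition undirected_tree :: "'a pair_pre_digraph \<Rightarrow> bool" where
  "undirected_tree G \<longleftrightarrow> pair_graph G \<and> connected (with_proj G) \<and>
     \<not> (\<exists>p. pre_digraph.cycle (with_proj G) p \<and> 3 \<le> length p)"

text \<open>
  Of the two arcs representing an edge, keep the one pointing away from \<open>r\<close>: the one that is
  traversed by (vertex-)simple paths starting at \<open>r\<close>.
\<close>

definition orient_away :: "'a \<Rightarrow> 'a pair_pre_digraph \<Rightarrow> 'a pair_pre_digraph" where
  "orient_away r G = \<lparr> pverts = pverts G,
     parcs = {e \<in> parcs G. \<exists>p v. pre_digraph.apath (with_proj G) r p v \<and> e \<in> set p} \<rparr>"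

text \<open>
  The root of a source tree is its only vertex without incoming arc, so a rooted tree is
  determined by its digraph and this set counts every rooted labelled tree exactly once.
\<close>

definition source_trees :: "nat \<Rightarrow> nat pair_pre_digraph set" where
  "source_trees n =
     {orient_away r T | r T. undirected_tree T \<and> pverts T = {1..n} \<and> r \<in> {1..n}}"

definition inverse_mapping_digraph :: "nat \<Rightarrow> (nat \<Rightarrow> nat) \<Rightarrow> nat pair_pre_digraph" where
  "inverse_mapping_digraph n f = \<lparr> pverts = {1..n}, parcs = {(f i, i) | i. i \<in> {1..n}} \<rparr>"

definition inverse_mapping_digraphs :: "nat \<Rightarrow> nat pair_pre_digraph set" where
  "inverse_mapping_digraphs n = inverse_mapping_digraph n ` ({1..n} \<rightarrow>\<^sub>E {1..n})"

definition F_tilde :: "nat \<Rightarrow> nat \<Rightarrow> nat" where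
  "F_tilde n m = (\<Sum>T\<in>source_trees n. num_parking_functions T m)"

definition M_tilde :: "nat \<Rightarrow> nat \<Rightarrow> nat" where
  "M_tilde n m = (\<Sum>M\<in>inverse_mapping_digraphs n. num_parking_functions M m)"

end

theory Submission
  imports Defs
begin

text \<open>
  A rooted tree whose edges point away from the root is a parent map in which the root is its own
  parent; the resulting loop at the root does not change who can park. So the
  claim compares two families of maps \<open>f\<close> on \<open>V = {1..n}\<close>: all of them, and the \<open>tree maps\<close>, those
  with exactly one fixed point that every orbit reaches. Both sides are sums over the preference
  lists \<open>s\<close>, and equality already holds for each \<open>s\<close> separately: there are \<open>n\<close> times as many maps
  as tree maps on which \<open>s\<close> parks.

  When all \<open>n\<close> drivers park, let \<open>\<phi> v\<close> be the number of times the edge into \<open>v\<close> is traversed. The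
  cars that start at \<open>v\<close> or drive into it either stay, which exactly one does, or drive on, so \<open>\<phi>\<close>
  is a flow with source \<open>count_list s\<close> and a sink of capacity one at every vertex. Conversely,
  drivers who only use edges with remaining flow park successfully
  (\<open>parking_function_iff_flow\<close>). Parking thus becomes the existence of a natural-valued flow.

  Such a flow is determined up to adding circulations along the directed cycles of \<open>f\<close>, so exactly
  one flow is reduced, that is, vanishes somewhere on every cycle. The edges that carry no
  flow in it may be redirected arbitrarily without affecting conservation. Detaching them turns
  \<open>f\<close> into a rooted forest \<open>h\<close> whose roots are the vertices of zero inflow, and the maps on which
  \<open>s\<close> parks are partitioned according to \<open>h\<close>; each class consists of all maps that agree with \<open>h\<close>
  off its roots (\<open>flow_completes_forest\<close>, \<open>completion_inherits_flow\<close>, \<open>flow_forest_unique\<close>).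

  It remains to compare the two families within one class. If \<open>h\<close> has \<open>k\<close> roots, then it has \<open>n ^ k\<close>
  completions, of which \<open>n ^ (k - 1)\<close> are tree maps: the classical count of the
  rooted trees that contain a given rooted spanning forest
  (\<open>card_completions\<close>, \<open>card_tree_completions\<close>). The quotient is \<open>n\<close> for every class.
\<close>

section \<open>Parking as a flow\<close>

text \<open>
  Conservation in the digraph with arcs \<open>(f y, y)\<close>: the vertex \<open>x\<close> has a single incoming arc, so
  \<open>\<phi> x\<close> stands for the flow on it, and the sum is the flow leaving \<open>x\<close>. Supply and demand are \<open>a\<close>
  and \<open>b\<close>. Writing supply and demand on different sides avoids subtraction of natural numbers.
\<close>

definition is_flow :: "'a set \<Rightarrow> ('a \<Rightarrow> 'a) \<Rightarrow> ('a \<Rightarrow> nat) \<Rightarrow> ('a \<Rightarrow> nat) \<Rightarrow> ('a \<Rightarrow> nat) \<Rightarrow> bool" where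
  "is_flow V f a b \<phi> \<longleftrightarrow> (\<forall>x\<in>V. a x + \<phi> x = b x + (\<Sum>y | y \<in> V \<and> f y = x. \<phi> y))"

lemma is_flow_add:
  assumes "is_flow V f a b \<phi>" "is_flow V f a' b' \<phi>'"
  shows "is_flow V f (\<lambda>x. a x + a' x) (\<lambda>x. b x + b' x) (\<lambda>x. \<phi> x + \<phi>' x)"
  using assms unfolding is_flow_def
proof (intro ballI)
  fix x assume x: "x \<in> V"
    and *: "\<forall>x\<in>V. a x + \<phi> x = b x + (\<Sum>y | y \<in> V \<and> f y = x. \<phi> y)"
      "\<forall>x\<in>V. a' x + \<phi>' x = b' x + (\<Sum>y | y \<in> V \<and> f y = x. \<phi>' y)"
  show "a x + a' x + (\<phi> x + \<phi>' x) = b x + b' x + (\<Sum>y | y \<in> V \<and> f y = x. \<phi> y + \<phi>' y)"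
    using *[THEN bspec, OF x] by (simp add: sum.distrib)
qed

lemma outflow_increment:
  fixes \<phi> :: "'a \<Rightarrow> nat"
  assumes "finite V" "w \<in> V"
  shows "(\<Sum>y | y \<in> V \<and> f y = x. (\<phi>(w := Suc (\<phi> w))) y)
           = (\<Sum>y | y \<in> V \<and> f y = x. \<phi> y) + of_bool (x = f w)"
proof (cases "x = f w")
  case True
  then have "w \<in> {y. y \<in> V \<and> f y = x}" "finite {y. y \<in> V \<and> f y = x}" using assms by auto
  then show ?thesis using True
    by (simp add: sum.remove[of _ w])
next
  case False
  then show ?thesis by (auto intro!: sum.cong)
qed

text \<open>
  The walk of a single driver is a unit flow from her start to her parking spot, counting how often
  each arc is used.
\<close>

lemma driver_parks_imp_flow:
  assumes "driver_parks D Occ u v" "finite V" "pverts D = V"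
    "parcs D = {(f i, i) | i. i \<in> V}"
  shows "v \<in> V \<and> v \<notin> Occ \<and>
    (\<exists>\<phi>. is_flow V f (\<lambda>x. of_bool (x = u)) (\<lambda>x. of_bool (x = v)) \<phi>)"
  using assms(1)
proof induction
  case (park u)
  have "is_flow V f (\<lambda>x. of_bool (x = u)) (\<lambda>x. of_bool (x = u)) (\<lambda>_. 0)"
    by (simp add: is_flow_def)
  then show ?case using park assms by blast
next
  case (drive u w v)
  then obtain \<phi> where \<phi>: "is_flow V f (\<lambda>x. of_bool (x = w)) (\<lambda>x. of_bool (x = v)) \<phi>" by blast
  have w: "w \<in> V" "f w = u" using drive assms by auto
  have "is_flow V f (\<lambda>x. of_bool (x = u)) (\<lambda>x. of_bool (x = v)) (\<phi>(w := Suc (\<phi> w)))"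
    using \<phi> unfolding is_flow_def outflow_increment[OF assms(2) w(1)] w(2) by auto
  then show ?case using drive by blast
qed

text \<open>
  The flows of the individual drivers add up; \<open>A\<close> is the set of the spots that they fill.
\<close>

lemma drivers_park_imp_flow:
  assumes "drivers_park D Occ s" "finite V" "pverts D = V"
    "parcs D = {(f i, i) | i. i \<in> V}"
  shows "\<exists>A \<phi>. A \<subseteq> V \<and> A \<inter> Occ = {} \<and> card A = length s \<and>
    is_flow V f (count_list s) (\<lambda>x. of_bool (x \<in> A)) \<phi>"
  using assms(1)
proof induction
  case (no_driver Occ)
  show ?case
    by (intro exI[of _ "{}"] exI[of _ "\<lambda>_. 0"]) (simp add: is_flow_def)
next
  case (next_driver Occ u v s)
  obtain \<phi>1 where 1: "v \<in> V" "v \<notin> Occ"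
      "is_flow V f (\<lambda>x. of_bool (x = u)) (\<lambda>x. of_bool (x = v)) \<phi>1"
    using driver_parks_imp_flow[OF next_driver(1) assms(2-4)] by blast
  obtain A \<phi> where 2: "A \<subseteq> V" "A \<inter> insert v Occ = {}" "card A = length s"
      "is_flow V f (count_list s) (\<lambda>x. of_bool (x \<in> A)) \<phi>"
    using next_driver by blast
  have "v \<notin> A" using 2 by auto
  have "(\<lambda>x. of_bool (x = u) + count_list s x) = count_list (u # s)"
    by (auto simp: fun_eq_iff)
  moreover have "(\<lambda>x. of_bool (x = v) + of_bool (x \<in> A)) = (\<lambda>x. of_bool (x \<in> insert v A) :: nat)"
    using \<open>v \<notin> A\<close> by (auto simp: fun_eq_iff)
  ultimately have "is_flow V f (count_list (u # s)) (\<lambda>x. of_bool (x \<in> insert v A)) (\<lambda>x. \<phi>1 x + \<phi> x)"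
    using is_flow_add[OF 1(3) 2(4)] by simp
  moreover have "card (insert v A) = length (u # s)"
    using 2 \<open>v \<notin> A\<close> finite_subset[OF 2(1) assms(2)] by simp
  moreover have "insert v A \<subseteq> V" "insert v A \<inter> Occ = {}"
    using 1 2 by auto
  ultimately show ?case by blast
qed

text \<open>
  A driver at an occupied vertex finds an outgoing arc that still carries flow, because she is
  herself part of the supply there and an occupied vertex demands nothing. Driving along this arc
  uses up one unit of it. The total flow therefore decreases, and she must stop at a free vertex.
\<close>

lemma flow_imp_driver_parks:
  assumes "is_flow V f (count_list (u # s)) (\<lambda>x. of_bool (x \<notin> Occ)) \<phi>" "u \<in> V"
    "finite V" "pverts D = V" "parcs D = {(f i, i) | i. i \<in> V}"
  shows "\<exists>v \<psi>. driver_parks D Occ u v \<and>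
    is_flow V f (count_list s) (\<lambda>x. of_bool (x \<notin> insert v Occ)) \<psi>"
  using assms(1,2)
proof (induction "sum \<phi> V" arbitrary: \<phi> u rule: less_induct)
  case less
  show ?case
  proof (cases "u \<in> Occ")
    case False
    then have "is_flow V f (count_list s) (\<lambda>x. of_bool (x \<notin> insert u Occ)) \<phi>"
      using less(2) by (auto simp: is_flow_def split: if_splits)
    then show ?thesis using driver_parks.park[of u D Occ] False less(3) assms(4) by blast
  next
    case True
    then have "(\<Sum>y | y \<in> V \<and> f y = u. \<phi> y) \<noteq> 0"
      using less(2,3) by (auto simp: is_flow_def simp del: sum_eq_0_iff)
    then obtain w where w: "w \<in> V" "f w = u" "\<phi> w \<noteq> 0"
      using assms(3) by (auto simp: sum_eq_0_iff)
    \<comment> \<open>One unit of the flow out of \<open>u\<close> is spent on the step to \<open>w\<close>.\<close>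
    define \<phi>' where "\<phi>' = \<phi>(w := \<phi> w - 1)"
    have \<phi>: "\<phi> = \<phi>'(w := Suc (\<phi>' w))" using w by (auto simp: \<phi>'_def)
    have "is_flow V f (count_list (w # s)) (\<lambda>x. of_bool (x \<notin> Occ)) \<phi>'"
      unfolding is_flow_def
    proof
      fix x assume "x \<in> V"
      have "count_list (u # s) x + \<phi> x = of_bool (x \<notin> Occ) + (\<Sum>y | y \<in> V \<and> f y = x. \<phi> y)"
        using less(2) \<open>x \<in> V\<close> by (simp add: is_flow_def)
      then show "count_list (w # s) x + \<phi>' x
          = of_bool (x \<notin> Occ) + (\<Sum>y | y \<in> V \<and> f y = x. \<phi>' y)"
        unfolding \<phi> outflow_increment[OF assms(3) w(1)] w(2)
        by (auto split: if_splits)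
    qed
    moreover have "sum \<phi>' V < sum \<phi> V"
      using w assms(3) by (intro sum_strict_mono_ex1) (auto simp: \<phi>'_def)
    ultimately obtain v \<psi> where v: "driver_parks D Occ w v"
        "is_flow V f (count_list s) (\<lambda>x. of_bool (x \<notin> insert v Occ)) \<psi>"
      using less(1) w(1) by blast
    moreover have "(u, w) \<in> parcs D" using w assms(5) by auto
    ultimately show ?thesis using True driver_parks.drive by metis
  qed
qed

text \<open>
  The remaining flow always routes the remaining drivers to the spots that are still free, which is
  the invariant under which the drivers are treated one after the other.
\<close>

lemma flow_imp_drivers_park:
  assumes "is_flow V f (count_list s) (\<lambda>x. of_bool (x \<notin> Occ)) \<phi>" "set s \<subseteq> V"
    "finite V" "pverts D = V" "parcs D = {(f i, i) | i. i \<in> V}"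
  shows "drivers_park D Occ s"
  using assms(1,2)
proof (induction s arbitrary: Occ \<phi>)
  case Nil
  then show ?case by (simp add: drivers_park.no_driver)
next
  case (Cons u s)
  then obtain v \<psi> where "driver_parks D Occ u v"
    "is_flow V f (count_list s) (\<lambda>x. of_bool (x \<notin> insert v Occ)) \<psi>"
    using flow_imp_driver_parks[OF _ _ assms(3-5)] by (metis list.set_intros(1) subsetD)
  then show ?case using Cons by (auto intro: drivers_park.next_driver)
qed

text \<open>
  With as many drivers as vertices every spot is filled, so the demand is constantly one.
\<close>

theorem parking_function_iff_flow:
  assumes "finite V" "pverts D = V" "parcs D = {(f i, i) | i. i \<in> V}"
    "set s \<subseteq> V" "length s = card V"
  shows "parking_function D s \<longleftrightarrow> (\<exists>\<phi>. is_flow V f (count_list s) (\<lambda>_. 1) \<phi>)"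
proof
  assume "parking_function D s"
  then obtain A \<phi> where A: "A \<subseteq> V" "card A = length s"
      "is_flow V f (count_list s) (\<lambda>x. of_bool (x \<in> A)) \<phi>"
    using drivers_park_imp_flow[OF _ assms(1-3), of "{}" s] unfolding parking_function_def by blast
  have "A = V" using card_subset_eq[OF assms(1) A(1)] A(2) assms(5) by simp
  then show "\<exists>\<phi>. is_flow V f (count_list s) (\<lambda>_. 1) \<phi>"
    using A(3) unfolding \<open>A = V\<close> by (intro exI[of _ \<phi>]) (simp add: is_flow_def)
next
  assume "\<exists>\<phi>. is_flow V f (count_list s) (\<lambda>_. 1) \<phi>"
  then obtain \<phi> where "is_flow V f (count_list s) (\<lambda>x. of_bool (x \<notin> {})) \<phi>" by auto
  from flow_imp_drivers_park[OF this assms(4,1-3)] show "parking_function D s"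
    using assms(2,4) by (simp add: parking_function_def)
qed

text \<open>
  Driving along a loop leads back to the same occupied vertex, so such a step can be skipped.
\<close>

lemma driver_parks_loops:
  assumes "pverts D' = pverts D" "parcs D' - Id = parcs D - Id" "driver_parks D Occ u v"
  shows "driver_parks D' Occ u v"
  using assms(3)
proof induction
  case (park u)
  then show ?case using assms by (intro driver_parks.park) auto
next
  case (drive u w v)
  show ?case
  proof (cases "u = w")
    case True
    then show ?thesis using drive by simp
  next
    case False
    then have "(u, w) \<in> parcs D'" using drive assms(2) by blast
    then show ?thesis using drive by (blast intro: driver_parks.drive)
  qed
qed

lemma drivers_park_loops:
  assumes "pverts D' = pverts D" "parcs D' - Id = parcs D - Id" "drivers_park D Occ s"
  shows "drivers_park D' Occ s"
  using assms(3)
proof induction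
  case (no_driver Occ)
  show ?case by (rule drivers_park.no_driver)
next
  case (next_driver Occ u v s)
  then show ?case
    using driver_parks_loops[OF assms(1,2)] drivers_park.next_driver by metis
qed

lemma num_parking_functions_loops:
  assumes "pverts D' = pverts D" "parcs D' - Id = parcs D - Id"
  shows "num_parking_functions D' m = num_parking_functions D m"
proof -
  have "parking_function D' s \<longleftrightarrow> parking_function D s" for s
    using drivers_park_loops[OF assms] drivers_park_loops[OF assms[symmetric]] assms(1)
    unfolding parking_function_def by auto
  then show ?thesis unfolding num_parking_functions_def by simp
qed

section \<open>Completing a rooted forest\<close>

definition roots :: "'a set \<Rightarrow> ('a \<Rightarrow> 'a) \<Rightarrow> 'a set" where
  "roots V f = {u \<in> V. f u = u}"

text \<open>
  A rooted forest, given by its parent map; roots are their own parents. Since orbits are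
  eventually periodic, demanding that each of them reaches a fixed point excludes all other cycles.
\<close>

definition forest_map :: "'a set \<Rightarrow> ('a \<Rightarrow> 'a) \<Rightarrow> bool" where
  "forest_map V f \<longleftrightarrow> f \<in> V \<rightarrow>\<^sub>E V \<and> (\<forall>u\<in>V. \<exists>k. f ((f ^^ k) u) = (f ^^ k) u)"

definition tree_map :: "'a set \<Rightarrow> ('a \<Rightarrow> 'a) \<Rightarrow> bool" where
  "tree_map V f \<longleftrightarrow> forest_map V f \<and> card (roots V f) = 1"

text \<open>
  The maps obtained from the forest \<open>h\<close> by choosing a new parent for every root, without any
  restriction: new cycles may arise, and a root may stay a root.
\<close>

definition completions :: "'a set \<Rightarrow> ('a \<Rightarrow> 'a) \<Rightarrow> ('a \<Rightarrow> 'a) set" where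
  "completions V h = {f \<in> V \<rightarrow>\<^sub>E V. \<forall>u\<in>V. h u \<noteq> u \<longrightarrow> f u = h u}"

definition basin :: "'a set \<Rightarrow> ('a \<Rightarrow> 'a) \<Rightarrow> 'a \<Rightarrow> 'a set" where
  "basin V h x = {u \<in> V. \<exists>k. (h ^^ k) u = x}"

lemma funpow_in:
  assumes "f \<in> V \<rightarrow>\<^sub>E V" "u \<in> V"
  shows "(f ^^ k) u \<in> V"
  using assms by (induction k) auto

lemma funpow_agree:
  assumes "\<And>j. j < k \<Longrightarrow> f ((h ^^ j) u) = h ((h ^^ j) u)"
  shows "(f ^^ k) u = (h ^^ k) u"
  using assms by (induction k) auto

lemma funpow_fixpoint:
  assumes "h x = x"
  shows "(h ^^ k) x = x"
  using assms by (induction k) auto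

lemma funpow_fixpoint_le:
  assumes "h ((h ^^ i) u) = (h ^^ i) u" "i \<le> j"
  shows "(h ^^ j) u = (h ^^ i) u"
proof -
  have "(h ^^ j) u = (h ^^ (j - i)) ((h ^^ i) u)"
    using assms(2) by (metis comp_apply funpow_add le_add_diff_inverse2)
  then show ?thesis using funpow_fixpoint[of h "(h ^^ i) u" "j - i"] assms(1) by simp
qed

lemma finite_completions: "finite V \<Longrightarrow> finite (completions V h)"
  unfolding completions_def by (simp add: finite_PiE)

lemma card_completions:
  assumes "finite V" "h \<in> V \<rightarrow>\<^sub>E V"
  shows "card (completions V h) = card V ^ card (roots V h)"
proof -
  have "completions V h = PiE V (\<lambda>u. if h u = u then V else {h u})"
    using assms(2) by (auto simp: completions_def PiE_iff split: if_splits) (auto simp: extensional_def)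
  then have "card (completions V h) = (\<Prod>u\<in>V. if h u = u then card V else 1)"
    using assms(1) by (simp add: card_PiE if_distrib cong: if_cong)
  also have "\<dots> = card V ^ card (roots V h)"
    using assms(1) by (simp add: prod.If_cases roots_def Int_def)
  finally show ?thesis .
qed

lemma sum_card_basin:
  assumes "finite V" "forest_map V h"
  shows "(\<Sum>x\<in>roots V h. card (basin V h x)) = card V"
proof -
  have h: "h \<in> V \<rightarrow>\<^sub>E V" using assms(2) by (simp add: forest_map_def)
  have "(\<Union>x\<in>roots V h. basin V h x) = V"
  proof
    show "V \<subseteq> (\<Union>x\<in>roots V h. basin V h x)"
    proof
      fix u assume u: "u \<in> V"
      then obtain k where "h ((h ^^ k) u) = (h ^^ k) u" using assms(2) by (auto simp: forest_map_def)
      then have "(h ^^ k) u \<in> roots V h" using funpow_in[OF h u] by (simp add: roots_def)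
      then show "u \<in> (\<Union>x\<in>roots V h. basin V h x)" using u by (auto simp: basin_def)
    qed
  qed (auto simp: basin_def)
  moreover have "basin V h x \<inter> basin V h y = {}"
    if "x \<in> roots V h" "y \<in> roots V h" "x \<noteq> y" for x y
  proof -
    have False if "(h ^^ i) u = x" "(h ^^ j) u = y" for u i j
      using funpow_fixpoint_le[of h i u j] funpow_fixpoint_le[of h j u i] that
        \<open>x \<in> _\<close> \<open>y \<in> _\<close> \<open>x \<noteq> y\<close> by (cases "i \<le> j") (auto simp: roots_def)
    then show ?thesis by (auto simp: basin_def)
  qed
  moreover have "finite (roots V h)" "\<And>x. finite (basin V h x)"
    using assms(1) by (auto simp: roots_def basin_def)
  ultimately show ?thesis using card_UN_disjoint[of "roots V h" "basin V h"] by simp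
qed

text \<open>
  The tree of \<open>x\<close> is grafted onto a vertex of another tree. Orbits that avoid \<open>x\<close> are unchanged,
  and orbits that meet \<open>x\<close> continue at \<open>y\<close>, whose orbit avoids \<open>x\<close>.
\<close>

lemma forest_map_attach:
  assumes "forest_map V h" "x \<in> roots V h" "y \<in> V - basin V h x"
  shows "forest_map V (h(x := y))" "roots V (h(x := y)) = roots V h - {x}"
proof -
  let ?h = "h(x := y)"
  have h: "h \<in> V \<rightarrow>\<^sub>E V" using assms(1) by (simp add: forest_map_def)
  have x: "x \<in> V" "h x = x" using assms(2) by (auto simp: roots_def)
  have "(h ^^ 0) x = x" by simp
  then have "x \<in> basin V h x" using x unfolding basin_def by blast
  then have "y \<noteq> x" using assms(3) by auto
  then show "roots V ?h = roots V h - {x}" by (auto simp: roots_def)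
  have outside: "\<exists>k. ?h ((?h ^^ k) u) = (?h ^^ k) u" if "u \<in> V - basin V h x" for u
  proof -
    have ne: "(h ^^ j) u \<noteq> x" for j using that by (auto simp: basin_def)
    have "(?h ^^ k) u = (h ^^ k) u" for k by (rule funpow_agree) (simp add: ne)
    moreover have "\<exists>k. h ((h ^^ k) u) = (h ^^ k) u"
      using assms(1) that by (simp add: forest_map_def)
    then obtain k where "h ((h ^^ k) u) = (h ^^ k) u" by blast
    ultimately have "?h ((?h ^^ k) u) = (?h ^^ k) u" using ne[of k] by simp
    then show ?thesis by blast
  qed
  have "\<exists>k. ?h ((?h ^^ k) u) = (?h ^^ k) u" if "u \<in> V" for u
  proof (cases "u \<in> basin V h x")
    case False
    then show ?thesis using outside that by blast
  next
    case True
    then have ex: "\<exists>k. (h ^^ k) u = x" by (auto simp: basin_def)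
    define m where "m = (LEAST k. (h ^^ k) u = x)"
    have m: "(h ^^ m) u = x" unfolding m_def using ex by (rule LeastI_ex)
    have "(h ^^ j) u \<noteq> x" if "j < m" for j
      using that not_less_Least unfolding m_def by blast
    then have "(?h ^^ m) u = x" using m funpow_agree[of m ?h h u] by simp
    then have *: "(?h ^^ Suc m) u = y" by simp
    obtain k where k: "?h ((?h ^^ k) y) = (?h ^^ k) y" using outside assms(3) by blast
    have "(?h ^^ (k + Suc m)) u = (?h ^^ k) y"
      unfolding funpow_add comp_apply * ..
    then show ?thesis using k by metis
  qed
  moreover have "?h \<in> V \<rightarrow>\<^sub>E V" using h x assms(3) by (auto simp: PiE_iff extensional_def)
  ultimately show "forest_map V ?h" by (simp add: forest_map_def)
qed

lemma forest_map_periodic: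
  assumes "forest_map V f" "x \<in> V" "(f ^^ Suc k) x = x"
  shows "f x = x"
proof -
  obtain m where m: "f ((f ^^ m) x) = (f ^^ m) x" using assms(1,2) by (auto simp: forest_map_def)
  \<comment> \<open>Going round the period \<open>m\<close> times passes the fixed point that the orbit of \<open>x\<close> reaches.\<close>
  have "((f ^^ Suc k) ^^ m) x = x" using assms(3) by (rule funpow_fixpoint)
  then have "(f ^^ (Suc k * m)) x = x" by (simp only: funpow_mult)
  moreover have "(f ^^ (Suc k * m)) x = (f ^^ m) x"
    using m by (rule funpow_fixpoint_le) simp
  ultimately show ?thesis using m by simp
qed

text \<open>
  Inside the tree of \<open>x\<close> the map \<open>f\<close> follows \<open>h\<close>, so an edge from \<open>x\<close> into its own tree would
  close a cycle.
\<close>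

lemma completion_attaches_outside_basin:
  assumes "forest_map V f" "f \<in> completions V h" "h \<in> V \<rightarrow>\<^sub>E V" "x \<in> V" "f x \<noteq> x"
  shows "f x \<in> V - basin V h x"
proof -
  have fx: "f x \<in> V" using assms(1,4) by (auto simp: forest_map_def)
  have False if "(h ^^ k) (f x) = x" for k
  proof -
    define m where "m = (LEAST k. (h ^^ k) (f x) = x)"
    have m: "(h ^^ m) (f x) = x" unfolding m_def using that by (rule LeastI)
    have least: "(h ^^ j) (f x) \<noteq> x" if "j < m" for j
      using that not_less_Least unfolding m_def by blast
    have "(f ^^ m) (f x) = (h ^^ m) (f x)"
    proof (rule funpow_agree)
      fix j assume j: "j < m"
      have "h ((h ^^ j) (f x)) \<noteq> (h ^^ j) (f x)"
        using funpow_fixpoint_le[of h j "f x" m] j m least[OF j] by auto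
      then show "f ((h ^^ j) (f x)) = h ((h ^^ j) (f x))"
        using assms(2) funpow_in[OF assms(3) fx, of j] by (auto simp: completions_def)
    qed
    then have "(f ^^ Suc m) x = x" using m by (simp add: funpow_swap1)
    then show False using forest_map_periodic[OF assms(1,4)] assms(5) by blast
  qed
  then show ?thesis using fx by (auto simp: basin_def)
qed

text \<open>
  This is the recursion behind the count of trees: a tree completion in which \<open>x\<close> is not the root
  is a tree completion of the forest in which \<open>x\<close> has already been grafted onto its new parent.
\<close>

lemma tree_completions_attached:
  assumes "forest_map V h" "x \<in> roots V h"
  shows "{f \<in> completions V h. tree_map V f \<and> f x \<noteq> x}
           = (\<Union>y\<in>V - basin V h x. {f \<in> completions V (h(x := y)). tree_map V f})"
    (is "?L = ?R")
proof
  have h: "h \<in> V \<rightarrow>\<^sub>E V" using assms(1) by (simp add: forest_map_def)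
  have x: "x \<in> V" "h x = x" using assms(2) by (auto simp: roots_def)
  show "?L \<subseteq> ?R"
  proof
    fix f assume f: "f \<in> ?L"
    then have "f x \<in> V - basin V h x"
      using completion_attaches_outside_basin[of V f h x] h x(1) by (auto simp: tree_map_def)
    moreover have "f \<in> completions V (h(x := f x))"
      using f by (auto simp: completions_def)
    ultimately show "f \<in> ?R" using f by blast
  qed
  have "(h ^^ 0) x = x" by simp
  then have xb: "x \<in> basin V h x" using x unfolding basin_def by blast
  show "?R \<subseteq> ?L"
  proof
    fix f assume "f \<in> ?R"
    then obtain y where y: "y \<in> V - basin V h x" "f \<in> completions V (h(x := y))" "tree_map V f"
      by blast
    have "y \<noteq> x" using y(1) xb by auto
    then have "f x \<noteq> x" using y(2) x(1) by (auto simp: completions_def)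
    moreover have "f \<in> completions V h"
      using y(2) x(2) unfolding completions_def by (auto split: if_splits)
    ultimately show "f \<in> ?L" using y(3) by blast
  qed
qed

text \<open>
  Let \<open>V\<close> have \<open>n\<close> elements and \<open>h\<close> have \<open>k + 2\<close> roots. The pairs of a tree completion and a root
  of \<open>h\<close> that does not become the root of the tree are counted in two ways. Each tree completion
  occurs in \<open>k + 1\<close> of them. On the other hand, such a pair arises by first grafting a root \<open>x\<close>
  onto one of the vertices outside its own tree. Since the trees of \<open>h\<close> partition \<open>V\<close>, there are
  \<open>(k + 2) * n - n = (k + 1) * n\<close> graftings, and each resulting forest with \<open>k + 1\<close> roots has
  \<open>n ^ k\<close> tree completions by induction.
\<close>

theorem card_tree_completions:
  assumes "finite V" "forest_map V h" "card (roots V h) = Suc k"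
  shows "card {f \<in> completions V h. tree_map V f} = card V ^ k"
  using assms(2,3)
proof (induction k arbitrary: h)
  case 0
  have h: "h \<in> V \<rightarrow>\<^sub>E V" using 0(1) by (simp add: forest_map_def)
  have "f = h" if f: "f \<in> completions V h" "tree_map V f" for f
  proof (rule PiE_ext[of f V "\<lambda>_. V" h])
    show "f \<in> V \<rightarrow>\<^sub>E V" using f by (simp add: completions_def)
    fix u assume u: "u \<in> V"
    have "roots V f \<subseteq> roots V h"
      using f(1) by (auto simp: completions_def roots_def)
    moreover have "finite (roots V h)" using assms(1) by (simp add: roots_def)
    ultimately have "roots V f = roots V h"
      using f(2) 0(2) by (intro card_subset_eq) (auto simp: tree_map_def)
    then have "f u = u \<longleftrightarrow> h u = u" using u unfolding roots_def by blast
    then show "f u = h u" using f(1) u by (cases "h u = u") (auto simp: completions_def)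
  qed (rule h)
  moreover have "h \<in> completions V h" "tree_map V h"
    using 0 h by (auto simp: completions_def tree_map_def)
  ultimately have "{f \<in> completions V h. tree_map V f} = {h}" by blast
  then show ?case by simp
next
  case (Suc k)
  let ?T = "\<lambda>h. {f \<in> completions V h. tree_map V f}"
  let ?X = "roots V h"
  have fin: "finite ?X" "finite (?T h')" for h'
    using assms(1) finite_completions[OF assms(1)] by (auto simp: roots_def)
  have "Suc k * card (?T h) = (\<Sum>f\<in>?T h. Suc k)" by simp
  also have "\<dots> = (\<Sum>x\<in>?X. card {f \<in> ?T h. f x \<noteq> x})"
  proof (rule sum_multicount_gen[symmetric])
    show "\<forall>f\<in>?T h. card {x \<in> ?X. f x \<noteq> x} = Suc k"
    proof
      fix f assume f: "f \<in> ?T h"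
      then have "roots V f \<subseteq> ?X" by (auto simp: completions_def roots_def)
      moreover have "{x \<in> ?X. f x \<noteq> x} = ?X - roots V f" by (auto simp: roots_def)
      ultimately show "card {x \<in> ?X. f x \<noteq> x} = Suc k"
        using f Suc(3) fin(1) by (simp add: card_Diff_subset tree_map_def finite_subset)
    qed
  qed (use fin in auto)
  also have "\<dots> = (\<Sum>x\<in>?X. (card V - card (basin V h x)) * card V ^ k)"
  proof (rule sum.cong[OF refl])
    fix x assume x: "x \<in> ?X"
    have disj: "?T (h(x := y)) \<inter> ?T (h(x := z)) = {}"
      if "y \<in> V - basin V h x" "z \<in> V - basin V h x" "y \<noteq> z" for y z
    proof -
      have xV: "x \<in> V" "(h ^^ 0) x = x" using x by (auto simp: roots_def)
      then have "x \<in> basin V h x" unfolding basin_def by blast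
      then have "f x = y" if "f \<in> completions V (h(x := y))" "y \<in> V - basin V h x" for f y
        using that xV by (auto simp: completions_def)
      then show ?thesis using that by blast
    qed
    have "{f \<in> ?T h. f x \<noteq> x} = (\<Union>y\<in>V - basin V h x. ?T (h(x := y)))"
      using tree_completions_attached[OF Suc(2) x] by auto
    also have "card \<dots> = (\<Sum>y\<in>V - basin V h x. card (?T (h(x := y))))"
      using disj fin(2) assms(1) by (intro card_UN_disjoint) auto
    also have "\<dots> = (\<Sum>y\<in>V - basin V h x. card V ^ k)"
    proof (rule sum.cong[OF refl])
      fix y assume y: "y \<in> V - basin V h x"
      have "card (roots V (h(x := y))) = Suc k"
        using forest_map_attach(2)[OF Suc(2) x y] Suc(3) x fin(1) by simp
      then show "card (?T (h(x := y))) = card V ^ k"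
        using Suc(1) forest_map_attach(1)[OF Suc(2) x y] by blast
    qed
    also have "\<dots> = (card V - card (basin V h x)) * card V ^ k"
      using assms(1) by (simp add: card_Diff_subset basin_def)
    finally show "card {f \<in> ?T h. f x \<noteq> x} = (card V - card (basin V h x)) * card V ^ k" .
  qed
  also have "\<dots> = (\<Sum>x\<in>?X. card V - card (basin V h x)) * card V ^ k"
    by (simp add: sum_distrib_right)
  also have "(\<Sum>x\<in>?X. card V - card (basin V h x)) = (\<Sum>x\<in>?X. card V) - (\<Sum>x\<in>?X. card (basin V h x))"
    using assms(1) by (intro sum_subtractf_nat) (auto simp: basin_def intro: card_mono)
  also have "\<dots> = Suc k * card V"
    using sum_card_basin[OF assms(1) Suc(2)] Suc(3) by simp
  finally have "Suc k * card (?T h) = Suc k * (card V * card V ^ k)" by (simp only: mult.assoc)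
  then have "card (?T h) = card V * card V ^ k" by (simp only: Suc_mult_cancel1)
  then show ?case by simp
qed

section \<open>Reduced flows\<close>

text \<open>
  The possible results of detaching the arcs without flow, for supply \<open>a\<close> and demand \<open>b\<close>. The flow
  on the loop of a root is required to vanish, since these loops replace the detached arcs.
\<close>

definition flow_forests :: "'a set \<Rightarrow> ('a \<Rightarrow> nat) \<Rightarrow> ('a \<Rightarrow> nat) \<Rightarrow> ('a \<Rightarrow> 'a) set" where
  "flow_forests V a b = {h. forest_map V h \<and>
     (\<exists>\<phi>. is_flow V h a b \<phi> \<and> (\<forall>u\<in>V. \<phi> u = 0 \<longleftrightarrow> h u = u))}"

lemma sum_outflow:
  assumes "finite V" "f \<in> V \<rightarrow>\<^sub>E V"
  shows "(\<Sum>x\<in>V. \<Sum>y | y \<in> V \<and> f y = x. g y) = sum g V"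
  using assms by (intro sum.group) auto

text \<open>
  The truncated difference of the two flows is at most its own outflow at every vertex. Both sides
  have the same sum over \<open>V\<close>, so they agree everywhere, and each summand of the outflow at \<open>f u\<close>
  is bounded by the value at \<open>f u\<close>.
\<close>

lemma flow_le_reduced_step:
  assumes "finite V" "f \<in> V \<rightarrow>\<^sub>E V" "is_flow V f a b \<phi>" "is_flow V f a b \<psi>" "u \<in> V"
  shows "\<phi> u - \<psi> u \<le> \<phi> (f u) - \<psi> (f u)"
proof -
  define \<delta> where "\<delta> = (\<lambda>x. \<phi> x - \<psi> x)"
  let ?out = "\<lambda>g x. \<Sum>y | y \<in> V \<and> f y = x. g y"
  have le: "\<delta> x \<le> ?out \<delta> x" if "x \<in> V" for x
  proof -
    have "?out \<phi> x \<le> ?out (\<lambda>y. \<psi> y + \<delta> y) x" by (rule sum_mono) (simp add: \<delta>_def)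
    moreover have "a x + \<phi> x = b x + ?out \<phi> x" "a x + \<psi> x = b x + ?out \<psi> x"
      using assms(3,4) that by (auto simp: is_flow_def)
    ultimately show ?thesis by (simp add: sum.distrib \<delta>_def)
  qed
  have "\<delta> (f u) = ?out \<delta> (f u)"
  proof (rule sum_mono_inv[of \<delta> V "?out \<delta>"])
    show "sum \<delta> V = sum (?out \<delta>) V" by (rule sum_outflow[OF assms(1,2), symmetric])
    show "f u \<in> V" using assms(2,5) by blast
  qed (use le assms(1) in auto)
  moreover have "\<delta> u \<le> ?out \<delta> (f u)"
    using assms(1,5) by (intro member_le_sum[of u]) auto
  ultimately show ?thesis by (simp add: \<delta>_def)
qed

text \<open>
  The excess of \<open>\<phi>\<close> over \<open>\<psi>\<close> does not decrease along an orbit, and it vanishes where \<open>\<phi>\<close> does.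
  Hence two flows that both vanish somewhere on every orbit are equal.
\<close>

lemma reduced_flow_least:
  assumes "finite V" "f \<in> V \<rightarrow>\<^sub>E V" "is_flow V f a b \<phi>" "is_flow V f a b \<psi>"
    "u \<in> V" "\<phi> ((f ^^ k) u) = 0"
  shows "\<phi> u \<le> \<psi> u"
proof -
  have "\<phi> u - \<psi> u \<le> \<phi> ((f ^^ j) u) - \<psi> ((f ^^ j) u)" for j
  proof (induction j)
    case (Suc j)
    then show ?case
      using flow_le_reduced_step[OF assms(1-4) funpow_in[OF assms(2,5), of j]] by simp
  qed simp
  from this[of k] show ?thesis using assms(6) by simp
qed

text \<open>
  This extracts the cycle in which the orbit ends, as a minimal nonempty subset closed under \<open>f\<close>.
\<close>

lemma orbit_contains_permuted_set:
  assumes "finite V" "f \<in> V \<rightarrow>\<^sub>E V" "u \<in> V"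
  shows "\<exists>C. C \<noteq> {} \<and> C \<subseteq> range (\<lambda>k. (f ^^ k) u) \<and> f ` C = C \<and> inj_on f C"
proof -
  define O' where "O' = range (\<lambda>k. (f ^^ k) u)"
  have "O' \<subseteq> V" unfolding O'_def using funpow_in[OF assms(2,3)] by blast
  then have fin: "finite C" if "C \<subseteq> O'" for C
    by (meson assms(1) finite_subset order_trans that)
  let ?P = "\<lambda>C. C \<noteq> {} \<and> C \<subseteq> O' \<and> f ` C \<subseteq> C"
  have "f ((f ^^ k) u) \<in> O'" for k
    unfolding O'_def by (rule image_eqI[of _ _ "Suc k"]) simp_all
  then have "f ` O' \<subseteq> O'" unfolding O'_def by blast
  moreover have "O' \<noteq> {}" by (simp add: O'_def)
  ultimately have "?P O'" by simp
  then have "\<exists>C. ?P C \<and> (\<forall>C'. ?P C' \<longrightarrow> card C \<le> card C')" by (rule ex_has_least_nat)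
  then obtain C where C: "?P C" "\<And>C'. ?P C' \<Longrightarrow> card C \<le> card C'" by blast
  then have "f ` C \<subseteq> C" "C \<subseteq> O'" "C \<noteq> {}" by auto
  then have "?P (f ` C)" by (simp add: image_mono subset_trans[of "f ` C" C])
  then have "card C \<le> card (f ` C)" by (rule C(2))
  then have img: "f ` C = C" using C(1) fin[of C] by (intro card_seteq) auto
  then have "inj_on f C" using fin[of C] C(1) by (intro eq_card_imp_inj_on) auto
  with C(1) img show ?thesis unfolding O'_def[symmetric] by blast
qed

text \<open>
  A flow with the least total is reduced: if it were positive along a whole orbit, then one unit
  could be removed from every arc of the cycle in which the orbit ends.
\<close>

lemma reduced_flow_exists:
  assumes "finite V" "f \<in> V \<rightarrow>\<^sub>E V" "is_flow V f a b \<phi>\<^sub>0"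
  shows "\<exists>\<phi>. is_flow V f a b \<phi> \<and> (\<forall>u\<in>V. \<exists>k. \<phi> ((f ^^ k) u) = 0)"
proof -
  obtain \<phi> where \<phi>: "is_flow V f a b \<phi>"
      and least: "\<And>\<psi>. is_flow V f a b \<psi> \<Longrightarrow> sum \<phi> V \<le> sum \<psi> V"
    using ex_has_least_nat[of "is_flow V f a b" \<phi>\<^sub>0 "\<lambda>\<phi>. sum \<phi> V"] assms(3) by blast
  have "\<exists>k. \<phi> ((f ^^ k) u) = 0" if u: "u \<in> V" for u
  proof (rule ccontr)
    assume pos: "\<nexists>k. \<phi> ((f ^^ k) u) = 0"
    obtain C where C: "C \<noteq> {}" "C \<subseteq> range (\<lambda>k. (f ^^ k) u)" "f ` C = C" "inj_on f C"
      using orbit_contains_permuted_set[OF assms(1,2) u] by blast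
    have CV: "C \<subseteq> V" using C(2) funpow_in[OF assms(2) u] by blast
    have posC: "\<phi> x > 0" if x: "x \<in> C" for x
    proof -
      obtain k where "x = (f ^^ k) u" using C(2) x by blast
      then show ?thesis using pos by (metis gr0I)
    qed
    \<comment> \<open>One unit less on every arc of the cycle \<open>C\<close>.\<close>
    define \<psi> where "\<psi> = (\<lambda>x. \<phi> x - of_bool (x \<in> C))"
    have \<phi>_eq: "\<phi> = (\<lambda>x. \<psi> x + of_bool (x \<in> C))"
      using posC by (auto simp: \<psi>_def fun_eq_iff Suc_leI)
    have out: "(\<Sum>y | y \<in> V \<and> f y = x. of_bool (y \<in> C)) = (of_bool (x \<in> C) :: nat)" for x
    proof -
      have "{y. y \<in> V \<and> f y = x} \<inter> {y. y \<in> C} = {y \<in> C. f y = x}" using CV by blast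
      then have "(\<Sum>y | y \<in> V \<and> f y = x. of_bool (y \<in> C)) = card {y \<in> C. f y = x}"
        using assms(1) by (subst sum_of_bool_eq) simp_all
      also have "\<dots> = of_bool (x \<in> C)"
      proof (cases "x \<in> C")
        case True
        then have "x \<in> f ` C" by (simp only: C(3))
        then obtain y where "y \<in> C" "f y = x" by blast
        then have "{y \<in> C. f y = x} = {y}" using inj_on_eq_iff[OF C(4)] by blast
        then show ?thesis using True by simp
      next
        case False
        then have "{y \<in> C. f y = x} = {}" using C(3) by blast
        then show ?thesis using False by (simp only: card.empty) simp
      qed
      finally show ?thesis .
    qed
    have "is_flow V f a b \<psi>"
      using \<phi> unfolding is_flow_def \<phi>_eq by (simp add: sum.distrib out)
    moreover obtain x where x: "x \<in> C" using C(1) by blast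
    have "sum \<psi> V < sum \<phi> V"
    proof (rule sum_strict_mono_ex1[OF assms(1)])
      show "\<forall>y\<in>V. \<psi> y \<le> \<phi> y" by (simp add: \<psi>_def)
      have "\<psi> x < \<phi> x" using x posC[OF x] by (simp add: \<psi>_def)
      then show "\<exists>y\<in>V. \<psi> y < \<phi> y" using x CV by blast
    qed
    ultimately show False using least[of \<psi>] by simp
  qed
  then show ?thesis using \<phi> by blast
qed

text \<open>
  Arcs without flow can be redirected. This is what makes the roots of a flow forest free to choose
  their parents.
\<close>

lemma is_flow_cong_support:
  assumes "finite V" "\<And>u. u \<in> V \<Longrightarrow> \<phi> u \<noteq> 0 \<Longrightarrow> f u = h u" "is_flow V f a b \<phi>"
  shows "is_flow V h a b \<phi>"
proof -
  have "(\<Sum>y | y \<in> V \<and> f y = x. \<phi> y) = (\<Sum>y | y \<in> V \<and> h y = x. \<phi> y)" for x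
    unfolding sum.inter_filter[OF assms(1)] by (rule sum.cong) (use assms(2) in force)+
  then show ?thesis using assms(3) by (simp add: is_flow_def)
qed

lemma flow_completes_forest:
  assumes "finite V" "f \<in> V \<rightarrow>\<^sub>E V" "is_flow V f a b \<phi>\<^sub>0"
  shows "\<exists>h\<in>flow_forests V a b. f \<in> completions V h"
proof -
  obtain \<phi> where \<phi>: "is_flow V f a b \<phi>" and red: "\<And>u. u \<in> V \<Longrightarrow> \<exists>k. \<phi> ((f ^^ k) u) = 0"
    using reduced_flow_exists[OF assms] by blast
  define h where "h = (\<lambda>u. if u \<in> V \<and> \<phi> u = 0 then u else f u)"
  have hV: "h \<in> V \<rightarrow>\<^sub>E V" using assms(2) by (auto simp: h_def PiE_iff extensional_def)
  have hit: "\<exists>k. \<phi> ((h ^^ k) u) = 0" if u: "u \<in> V" for u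
  proof -
    define m where "m = (LEAST k. \<phi> ((f ^^ k) u) = 0)"
    have m: "\<phi> ((f ^^ m) u) = 0" unfolding m_def using red[OF u] by (rule LeastI_ex)
    have "\<phi> ((f ^^ j) u) \<noteq> 0" if "j < m" for j
      using that not_less_Least unfolding m_def by blast
    then have "h ((f ^^ j) u) = f ((f ^^ j) u)" if "j < m" for j
      using that by (simp only: h_def) simp
    then have "(h ^^ m) u = (f ^^ m) u" by (rule funpow_agree)
    then have "\<phi> ((h ^^ m) u) = 0" using m by simp
    then show ?thesis by blast
  qed
  have "forest_map V h"
    unfolding forest_map_def
  proof (intro conjI ballI)
    fix u assume u: "u \<in> V"
    then obtain k where "\<phi> ((h ^^ k) u) = 0" using hit by blast
    then have "h ((h ^^ k) u) = (h ^^ k) u"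
      using funpow_in[OF hV u, of k] by (simp add: h_def)
    then show "\<exists>k. h ((h ^^ k) u) = (h ^^ k) u" by blast
  qed (rule hV)
  moreover have "is_flow V h a b \<phi>"
    by (rule is_flow_cong_support[OF assms(1) _ \<phi>]) (simp add: h_def)
  moreover have "\<phi> u = 0 \<longleftrightarrow> h u = u" if "u \<in> V" for u
  proof
    assume "h u = u"
    obtain k where "\<phi> ((h ^^ k) u) = 0" using hit \<open>u \<in> V\<close> by blast
    then show "\<phi> u = 0" using funpow_fixpoint[of h u k] \<open>h u = u\<close> by simp
  qed (simp add: h_def that)
  ultimately have "h \<in> flow_forests V a b" by (auto simp: flow_forests_def)
  moreover have "f \<in> completions V h" using assms(2) by (auto simp: completions_def h_def)
  ultimately show ?thesis by blast
qed

lemma completion_inherits_flow: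
  assumes "finite V" "f \<in> completions V h" "is_flow V h a b \<phi>" "\<forall>u\<in>V. \<phi> u = 0 \<longleftrightarrow> h u = u"
  shows "is_flow V f a b \<phi>"
  by (rule is_flow_cong_support[OF assms(1) _ assms(3)])
     (use assms(2,4) in \<open>auto simp: completions_def\<close>)

lemma completion_reduced:
  assumes "finite V" "f \<in> completions V h" "forest_map V h" "u \<in> V"
    "\<forall>u\<in>V. \<phi> u = (0::nat) \<longleftrightarrow> h u = u"
  shows "\<exists>k. \<phi> ((f ^^ k) u) = 0"
proof -
  have hV: "h \<in> V \<rightarrow>\<^sub>E V" using assms(3) by (simp add: forest_map_def)
  have ex: "\<exists>k. h ((h ^^ k) u) = (h ^^ k) u" using assms(3,4) by (simp add: forest_map_def)
  define m where "m = (LEAST k. h ((h ^^ k) u) = (h ^^ k) u)"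
  have m: "h ((h ^^ m) u) = (h ^^ m) u" unfolding m_def using ex by (rule LeastI_ex)
  have ne: "h ((h ^^ j) u) \<noteq> (h ^^ j) u" if "j < m" for j
    using that not_less_Least unfolding m_def by blast
  have "(f ^^ m) u = (h ^^ m) u"
  proof (rule funpow_agree)
    fix j assume "j < m"
    then show "f ((h ^^ j) u) = h ((h ^^ j) u)"
      using assms(2) funpow_in[OF hV assms(4), of j] ne[of j] by (simp add: completions_def)
  qed
  then have "\<phi> ((f ^^ m) u) = 0" using m assms(5) funpow_in[OF hV assms(4), of m] by simp
  then show ?thesis by blast
qed

lemma flow_forest_unique:
  assumes "finite V" "h \<in> flow_forests V a b" "h' \<in> flow_forests V a b"
    "f \<in> completions V h" "f \<in> completions V h'"
  shows "h = h'"
proof -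
  obtain \<phi> where \<phi>: "is_flow V h a b \<phi>" "\<forall>u\<in>V. \<phi> u = 0 \<longleftrightarrow> h u = u" and h: "forest_map V h"
    using assms(2) unfolding flow_forests_def by blast
  obtain \<phi>' where \<phi>': "is_flow V h' a b \<phi>'" "\<forall>u\<in>V. \<phi>' u = 0 \<longleftrightarrow> h' u = u" and h': "forest_map V h'"
    using assms(3) unfolding flow_forests_def by blast
  have fV: "f \<in> V \<rightarrow>\<^sub>E V" using assms(4) by (simp add: completions_def)
  have fl: "is_flow V f a b \<phi>" "is_flow V f a b \<phi>'"
    using completion_inherits_flow assms(1,4,5) \<phi> \<phi>' by blast+
  have "\<phi> u = \<phi>' u" if "u \<in> V" for u
    using reduced_flow_least[OF assms(1) fV fl that] reduced_flow_least[OF assms(1) fV fl(2,1) that]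
      completion_reduced[OF assms(1,4) h that \<phi>(2)] completion_reduced[OF assms(1,5) h' that \<phi>'(2)]
    by (meson le_antisym)
  then have "h u = u \<longleftrightarrow> h' u = u" if "u \<in> V" for u using \<phi>(2) \<phi>'(2) that by auto
  moreover have "h u \<noteq> u \<Longrightarrow> f u = h u" "h' u \<noteq> u \<Longrightarrow> f u = h' u" if "u \<in> V" for u
    using assms(4,5) that unfolding completions_def by blast+
  ultimately have "h u = h' u" if "u \<in> V" for u using that by metis
  then show ?thesis using h h' by (intro PiE_ext[of h V "\<lambda>_. V" h']) (auto simp: forest_map_def)
qed

text \<open>
  Both sets are partitioned by the flow forest that a map completes, and in each part the ratio is
  \<open>card V\<close>. A forest on a nonempty set has a root, so the exponent \<open>k\<close> of
  \<open>card_tree_completions\<close> is available.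
\<close>

theorem card_tree_maps_with_flow:
  assumes "finite V" "V \<noteq> {}"
  shows "card V * card {f. tree_map V f \<and> (\<exists>\<phi>. is_flow V f a b \<phi>)}
           = card {f \<in> V \<rightarrow>\<^sub>E V. \<exists>\<phi>. is_flow V f a b \<phi>}"
proof -
  let ?H = "flow_forests V a b"
  have finH: "finite ?H"
    by (rule finite_subset[of _ "V \<rightarrow>\<^sub>E V"])
       (use assms(1) in \<open>auto simp: flow_forests_def forest_map_def finite_PiE\<close>)
  have flow_iff: "(\<exists>\<phi>. is_flow V f a b \<phi>) \<longleftrightarrow> (\<exists>h\<in>?H. f \<in> completions V h)"
    if "f \<in> V \<rightarrow>\<^sub>E V" for f
    using flow_completes_forest[OF assms(1) that] completion_inherits_flow[OF assms(1)]
    unfolding flow_forests_def by blast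
  have "{f \<in> V \<rightarrow>\<^sub>E V. \<exists>\<phi>. is_flow V f a b \<phi>} = (\<Union>h\<in>?H. completions V h)"
  proof -
    have "f \<in> V \<rightarrow>\<^sub>E V" if "f \<in> completions V h" for f h
      using that by (simp add: completions_def)
    then have "(f \<in> V \<rightarrow>\<^sub>E V \<and> (\<exists>\<phi>. is_flow V f a b \<phi>))
        \<longleftrightarrow> (\<exists>h\<in>?H. f \<in> completions V h)" for f
      using flow_iff[of f] by metis
    then show ?thesis unfolding set_eq_iff mem_Collect_eq UN_iff by blast
  qed
  moreover have "card (\<Union>h\<in>?H. completions V h) = (\<Sum>h\<in>?H. card (completions V h))"
    by (rule card_UN_disjoint)
       (use finH finite_completions[OF assms(1)] flow_forest_unique[OF assms(1)] in blast)+
  moreover have "{f. tree_map V f \<and> (\<exists>\<phi>. is_flow V f a b \<phi>)}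
      = (\<Union>h\<in>?H. {f \<in> completions V h. tree_map V f})"
  proof -
    have "f \<in> V \<rightarrow>\<^sub>E V" if "tree_map V f" for f
      using that by (simp add: tree_map_def forest_map_def)
    then have "(tree_map V f \<and> (\<exists>\<phi>. is_flow V f a b \<phi>))
        \<longleftrightarrow> (\<exists>h\<in>?H. f \<in> completions V h \<and> tree_map V f)" for f
      using flow_iff[of f] by metis
    then show ?thesis unfolding set_eq_iff mem_Collect_eq UN_iff by blast
  qed
  moreover have "card (\<Union>h\<in>?H. {f \<in> completions V h. tree_map V f})
      = (\<Sum>h\<in>?H. card {f \<in> completions V h. tree_map V f})"
    by (rule card_UN_disjoint)
       (use finH finite_completions[OF assms(1)] flow_forest_unique[OF assms(1)] in auto)
  moreover have "card (completions V h) = card V * card {f \<in> completions V h. tree_map V f}"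
    if "h \<in> ?H" for h
  proof -
    have h: "forest_map V h" using that by (simp add: flow_forests_def)
    then have hV: "h \<in> V \<rightarrow>\<^sub>E V" by (simp add: forest_map_def)
    obtain u where u: "u \<in> V" using assms(2) by blast
    then obtain k where "h ((h ^^ k) u) = (h ^^ k) u" using h by (auto simp: forest_map_def)
    then have "(h ^^ k) u \<in> roots V h" using funpow_in[OF hV u] by (simp add: roots_def)
    moreover have "finite (roots V h)" using assms(1) by (simp add: roots_def)
    ultimately obtain k where "card (roots V h) = Suc k"
      by (metis card_gt_0_iff empty_iff gr0_implies_Suc)
    then show ?thesis
      using card_completions[OF assms(1) hV] card_tree_completions[OF assms(1) h] by simp
  qed
  ultimately show ?thesis by (simp add: sum_distrib_left)
qed

section \<open>Source trees as parent maps\<close>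

definition tree_digraph :: "'a set \<Rightarrow> ('a \<Rightarrow> 'a) \<Rightarrow> 'a pair_pre_digraph" where
  "tree_digraph V f = \<lparr> pverts = V, parcs = {(f i, i) | i. i \<in> V \<and> f i \<noteq> i} \<rparr>"

definition underlying_graph :: "'a set \<Rightarrow> ('a \<Rightarrow> 'a) \<Rightarrow> 'a pair_pre_digraph" where
  "underlying_graph V f = mk_symmetric (with_proj (tree_digraph V f))"

lemma pverts_underlying_graph [simp]: "pverts (underlying_graph V f) = V"
  by (simp add: underlying_graph_def mk_symmetric_def tree_digraph_def)

lemma parcs_underlying_graph:
  assumes "f \<in> V \<rightarrow>\<^sub>E V"
  shows "(a, b) \<in> parcs (underlying_graph V f)
     \<longleftrightarrow> a \<in> V \<and> b \<in> V \<and> a \<noteq> b \<and> (a = f b \<or> b = f a)"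
proof -
  have "(a, b) \<in> parcs (underlying_graph V f)
      \<longleftrightarrow> (b \<in> V \<and> f b \<noteq> b \<and> a = f b) \<or> (a \<in> V \<and> f a \<noteq> a \<and> b = f a)"
    unfolding underlying_graph_def parcs_mk_symmetric by (auto simp: tree_digraph_def)
  moreover have "f a \<in> V" if "a \<in> V" for a using assms that by blast
  ultimately show ?thesis by metis
qed

lemma awalk_with_proj_iff:
  "pre_digraph.awalk (with_proj G) u p v \<longleftrightarrow> u \<in> pverts G \<and> set p \<subseteq> parcs G \<and> pcas u p v"
  by (simp add: pre_digraph.awalk_def cas_with_proj_eq)

lemma pawalk_verts_eq: "pcas u p v \<Longrightarrow> pawalk_verts u p = u # map snd p"
  by (induction p arbitrary: u) auto

lemma apath_with_proj_iff:
  "pre_digraph.apath (with_proj G) u p v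
     \<longleftrightarrow> u \<in> pverts G \<and> set p \<subseteq> parcs G \<and> pcas u p v \<and> distinct (u # map snd p)"
  unfolding pre_digraph.apath_def awalk_with_proj_iff awalk_verts_with_proj_eq
  using pawalk_verts_eq[of u p v] by (cases "pcas u p v") simp_all

lemma cycle_with_proj_iff:
  "pre_digraph.cycle (with_proj G) p
     \<longleftrightarrow> (\<exists>u. u \<in> pverts G \<and> set p \<subseteq> parcs G \<and> pcas u p u \<and> distinct (map snd p) \<and> p \<noteq> [])"
  unfolding pre_digraph.cycle_def awalk_with_proj_iff awalk_verts_with_proj_eq
  using pawalk_verts_eq[of _ p] by (metis list.sel(3))

lemma pcas_last: "pcas u p v \<Longrightarrow> p \<noteq> [] \<Longrightarrow> snd (last p) = v"
  by (induction p arbitrary: u) auto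

lemma pcas_append: "pcas u (p @ q) w \<longleftrightarrow> (\<exists>v. pcas u p v \<and> pcas v q w)"
  by (induction p arbitrary: u) auto

lemma pcas_nth: "pcas u p v \<Longrightarrow> Suc i < length p \<Longrightarrow> fst (p ! Suc i) = snd (p ! i)"
proof (induction p arbitrary: u i)
  case (Cons e p)
  then show ?case by (cases i; cases p) auto
qed simp

definition depth :: "('a \<Rightarrow> 'a) \<Rightarrow> 'a \<Rightarrow> nat" where
  "depth f u = (LEAST k. f ((f ^^ k) u) = (f ^^ k) u)"

lemma depth_parent_less:
  assumes "forest_map V f" "u \<in> V" "f u \<noteq> u"
  shows "depth f (f u) < depth f u"
proof -
  have "\<exists>k. f ((f ^^ k) u) = (f ^^ k) u" using assms by (simp add: forest_map_def)
  then have d: "f ((f ^^ depth f u) u) = (f ^^ depth f u) u"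
    unfolding depth_def by (rule LeastI_ex)
  then obtain m where m: "depth f u = Suc m" using assms(3) by (cases "depth f u") auto
  have "f ((f ^^ m) (f u)) = (f ^^ m) (f u)" using d unfolding m by (simp add: funpow_swap1)
  then have "depth f (f u) \<le> m" unfolding depth_def by (rule Least_le)
  then show ?thesis using m by simp
qed

text \<open>
  At a deepest vertex of a cycle, both neighbours on the cycle are the parent. In a cycle of
  length at least three the two neighbours are distinct.
\<close>

lemma underlying_graph_no_cycle:
  assumes "forest_map V f" "pre_digraph.cycle (with_proj (underlying_graph V f)) p"
  shows "length p < 3"
proof (rule ccontr)
  assume "\<not> length p < 3"
  then have len: "3 \<le> length p" by simp
  have fV: "f \<in> V \<rightarrow>\<^sub>E V" using assms(1) by (simp add: forest_map_def)
  obtain u where arcs: "set p \<subseteq> parcs (underlying_graph V f)" and walk: "pcas u p u"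
      and dist: "distinct (map snd p)"
    using assms(2) unfolding cycle_with_proj_iff by blast
  define L where "L = length p"
  \<comment> \<open>The walk is closed, so its arcs are indexed cyclically.\<close>
  define succ where "succ i = (if Suc i = L then 0 else Suc i)" for i
  define pred where "pred i = (if i = 0 then L - 1 else i - 1)" for i
  have p_ne: "p \<noteq> []" using len by auto
  have wrap: "fst (p ! 0) = snd (p ! (L - 1))"
  proof -
    have "fst (p ! 0) = u" using walk p_ne by (cases p) auto
    then show ?thesis using pcas_last[OF walk p_ne] last_conv_nth[OF p_ne] by (simp add: L_def)
  qed
  have step: "fst (p ! succ i) = snd (p ! i)" if "i < L" for i
  proof (cases "Suc i = L")
    case True
    then have "i = L - 1" by simp
    then show ?thesis using wrap True by (simp add: succ_def)
  next
    case False
    then show ?thesis using that pcas_nth[OF walk, of i] by (simp add: succ_def L_def)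
  qed
  have pred: "pred i < L" "succ (pred i) = i" if "i < L" for i
    using that by (auto simp: pred_def succ_def)
  have succ: "succ i < L" "succ i \<noteq> pred i" if "i < L" for i
    using that len unfolding succ_def pred_def L_def[symmetric] by auto
  obtain i where i: "i < L" and deepest: "\<And>j. j < L \<Longrightarrow> depth f (snd (p ! j)) \<le> depth f (snd (p ! i))"
  proof -
    have "finite {..<L}" "0 \<in> {..<L}" using p_ne by (simp_all add: L_def)
    then have "\<exists>i\<in>{..<L}. \<forall>j\<in>{..<L}. depth f (snd (p ! j)) \<le> depth f (snd (p ! i))"
      using Max_in[of "(\<lambda>j. depth f (snd (p ! j))) ` {..<L}"]
        Max_ge[of "(\<lambda>j. depth f (snd (p ! j))) ` {..<L}"] by fastforce
    then show ?thesis using that by blast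
  qed
  define x where "x = snd (p ! i)"
  have parent: "y = f x"
    if "(y, x) \<in> parcs (underlying_graph V f) \<or> (x, y) \<in> parcs (underlying_graph V f)"
      "depth f y \<le> depth f x" for y
    using that depth_parent_less[OF assms(1), of y] by (auto simp: parcs_underlying_graph[OF fV])
  have arc: "p ! j \<in> parcs (underlying_graph V f)" if "j < L" for j
    using that arcs by (auto simp: L_def)
  have "fst (p ! i) = snd (p ! pred i)" using step[of "pred i"] pred[OF i] by simp
  then have "p ! i = (snd (p ! pred i), x)" unfolding x_def by (simp add: prod_eq_iff)
  then have "snd (p ! pred i) = f x"
    using arc[OF i] deepest[OF pred(1)[OF i]] by (intro parent) (simp_all add: x_def)
  moreover have "p ! succ i = (x, snd (p ! succ i))" using step[OF i] by (simp add: x_def prod_eq_iff)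
  then have "snd (p ! succ i) = f x"
    using arc[OF succ(1)[OF i]] deepest[OF succ(1)[OF i]] by (intro parent) (simp_all add: x_def)
  ultimately have "map snd p ! pred i = map snd p ! succ i"
    using pred[OF i] succ[OF i] by (simp add: L_def)
  then show False
    using nth_eq_iff_index_eq[OF dist, of "pred i" "succ i"] pred(1)[OF i] succ[OF i]
    by (simp add: L_def)
qed

lemma pair_graph_underlying_graph:
  assumes "finite V" "f \<in> V \<rightarrow>\<^sub>E V"
  shows "pair_graph (underlying_graph V f)"
proof -
  have arcs: "parcs (underlying_graph V f) \<subseteq> V \<times> V"
    using parcs_underlying_graph[OF assms(2)] by auto
  have "sym (parcs (underlying_graph V f))"
    using parcs_underlying_graph[OF assms(2)] by (auto intro!: symI)
  then show ?thesis
    using arcs assms(1) finite_subset[OF arcs] parcs_underlying_graph[OF assms(2)]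
    by unfold_locales (auto simp: symmetric_def)
qed

lemma tree_map_has_root:
  assumes "tree_map V f"
  shows "\<exists>r\<in>V. f r = r"
proof -
  have "card (roots V f) = 1" using assms by (simp add: tree_map_def)
  then obtain r where "roots V f = {r}" by (rule card_1_singletonE)
  then show ?thesis by (auto simp: roots_def)
qed

lemma tree_map_root:
  assumes "tree_map V f" "f r = r" "r \<in> V"
  shows "roots V f = {r}"
proof -
  have "card (roots V f) = 1" using assms(1) by (simp add: tree_map_def)
  then obtain x where "roots V f = {x}" by (rule card_1_singletonE)
  moreover have "r \<in> roots V f" using assms by (simp add: roots_def)
  ultimately show ?thesis by auto
qed

lemma reachable_root_underlying_graph:
  assumes "finite V" "tree_map V f" "f r = r" "r \<in> V" "u \<in> V"
  shows "u \<rightarrow>\<^sup>*\<^bsub>with_proj (underlying_graph V f)\<^esub> r"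
proof -
  have f: "forest_map V f" using assms(2) by (simp add: tree_map_def)
  then have fV: "f \<in> V \<rightarrow>\<^sub>E V" by (simp add: forest_map_def)
  interpret G: pair_graph "underlying_graph V f"
    by (rule pair_graph_underlying_graph[OF assms(1) fV])
  have "u \<rightarrow>\<^sup>*\<^bsub>with_proj (underlying_graph V f)\<^esub> (f ^^ k) u" for k
  proof (induction k)
    case 0
    then show ?case using assms(5) by simp
  next
    case (Suc k)
    let ?w = "(f ^^ k) u"
    have w: "?w \<in> V" by (rule funpow_in[OF fV assms(5)])
    show ?case
    proof (cases "f ?w = ?w")
      case True
      then show ?thesis using Suc by simp
    next
      case False
      then have "(?w, f ?w) \<in> parcs (underlying_graph V f)"
        using w fV by (auto simp: parcs_underlying_graph[OF fV])
      then show ?thesis using G.reachable_adj_trans[OF Suc] by simp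
    qed
  qed
  moreover obtain k where "f ((f ^^ k) u) = (f ^^ k) u" using f assms(5) by (auto simp: forest_map_def)
  then have "(f ^^ k) u = r"
    using tree_map_root[OF assms(2-4)] funpow_in[OF fV assms(5), of k] by (auto simp: roots_def)
  ultimately show ?thesis by metis
qed

lemma reachable_underlying_graph:
  assumes "finite V" "tree_map V f" "u \<in> V" "v \<in> V"
  shows "u \<rightarrow>\<^sup>*\<^bsub>with_proj (underlying_graph V f)\<^esub> v"
proof -
  obtain r where r: "r \<in> V" "f r = r"
    using tree_map_has_root[OF assms(2)] by blast
  have "f \<in> V \<rightarrow>\<^sub>E V" using assms(2) by (simp add: tree_map_def forest_map_def)
  then interpret G: pair_graph "underlying_graph V f"
    by (rule pair_graph_underlying_graph[OF assms(1)])
  show ?thesis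
    using reachable_root_underlying_graph[OF assms(1,2) r(2,1)] assms(3,4)
      G.reachable_trans G.symmetric_reachable' by blast
qed

lemma undirected_tree_underlying_graph:
  assumes "finite V" "tree_map V f"
  shows "undirected_tree (underlying_graph V f)"
proof -
  have f: "forest_map V f" using assms(2) by (simp add: tree_map_def)
  then have fV: "f \<in> V \<rightarrow>\<^sub>E V" by (simp add: forest_map_def)
  interpret G: pair_graph "underlying_graph V f"
    by (rule pair_graph_underlying_graph[OF assms(1) fV])
  have "V \<noteq> {}" using assms(2) by (auto simp: tree_map_def roots_def)
  moreover have "u \<rightarrow>\<^sup>*\<^bsub>with_proj (mk_symmetric (with_proj (underlying_graph V f)))\<^esub> v"
    if "u \<in> V" "v \<in> V" for u v
    by (rule G.reachable_mk_symmetricI[OF reachable_underlying_graph[OF assms that]])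
  ultimately have "connected (with_proj (underlying_graph V f))"
    by (intro G.connectedI) auto
  then show ?thesis
    unfolding undirected_tree_def
    using underlying_graph_no_cycle[OF f] G.pair_graph by (meson not_le)
qed

text \<open>
  A path that has once gone from a parent to a child cannot go back up, since the only way up leads
  to the vertex it came from. The assumption on \<open>f u\<close> carries this through the induction; for a
  path from the root it follows from \<open>f r = r\<close>.
\<close>

lemma path_from_root_descends:
  assumes "pcas u p v" "set p \<subseteq> parcs (underlying_graph V f)" "distinct (u # map snd p)"
    "f u \<notin> set (map snd p)" "f \<in> V \<rightarrow>\<^sub>E V" "e \<in> set p"
  shows "fst e = f (snd e)"
  using assms
proof (induction p arbitrary: u)
  case (Cons a p)
  obtain w where a: "a = (u, w)" using Cons.prems(1) by (cases a) auto
  then have "(u, w) \<in> parcs (underlying_graph V f)" using Cons.prems(2) by auto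
  moreover have "w \<noteq> f u" using Cons.prems(4) a by auto
  ultimately have u: "u = f w" using parcs_underlying_graph[OF Cons.prems(5), of u w] by blast
  show ?case
  proof (cases "e = a")
    case True
    then show ?thesis using a u by simp
  next
    case False
    have "fst e = f (snd e)"
    proof (rule Cons.IH)
      show "pcas w p v" using Cons.prems(1) a by simp
      show "set p \<subseteq> parcs (underlying_graph V f)" using Cons.prems(2) by simp
      show "distinct (w # map snd p)" using Cons.prems(3) a by simp
      show "f w \<notin> set (map snd p)" using Cons.prems(3) u by simp
      show "f \<in> V \<rightarrow>\<^sub>E V" by (rule Cons.prems(5))
      show "e \<in> set p" using Cons.prems(6) False by simp
    qed
    then show ?thesis .
  qed
qed simp

text \<open>
  The arc into a vertex is the last arc of the path from the root to that vertex, so every arc that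
  points away from the root lies on some path.
\<close>

lemma orient_away_underlying_graph:
  assumes "finite V" "tree_map V f" "f r = r" "r \<in> V"
  shows "orient_away r (underlying_graph V f) = tree_digraph V f"
proof -
  let ?G = "underlying_graph V f"
  have fV: "f \<in> V \<rightarrow>\<^sub>E V" using assms(2) by (simp add: tree_map_def forest_map_def)
  interpret G: pair_graph ?G by (rule pair_graph_underlying_graph[OF assms(1) fV])
  have down: "fst e = f (snd e)"
    if "pre_digraph.apath (with_proj ?G) r p v" "e \<in> set p" for e p v
    using path_from_root_descends[of r p v V f e] that fV assms(3)
    unfolding apath_with_proj_iff by auto
  have iff: "(a, b) \<in> parcs ?G \<and> (\<exists>p v. pre_digraph.apath (with_proj ?G) r p v \<and> (a, b) \<in> set p)
      \<longleftrightarrow> b \<in> V \<and> a = f b \<and> f b \<noteq> b" (is "?L \<longleftrightarrow> ?R") for a b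
  proof
    assume ?L
    then show ?R using down parcs_underlying_graph[OF fV, of a b] by fastforce
  next
    assume R: ?R
    then have "r \<rightarrow>\<^sup>*\<^bsub>with_proj ?G\<^esub> b" using reachable_underlying_graph[OF assms(1,2,4)] by blast
    then obtain p where p: "pre_digraph.apath (with_proj ?G) r p b" using G.reachable_apath by blast
    have "p \<noteq> []" using p R assms(3) by (auto simp: apath_with_proj_iff)
    then have "last p \<in> set p" "snd (last p) = b"
      using p pcas_last by (auto simp: apath_with_proj_iff)
    moreover from this have "fst (last p) = a" using down[OF p] R by auto
    ultimately have "(a, b) \<in> set p" by (metis prod.collapse)
    then show ?L using p by (auto simp: apath_with_proj_iff)
  qed
  have "{e \<in> parcs ?G. \<exists>p v. pre_digraph.apath (with_proj ?G) r p v \<and> e \<in> set p}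
      = {(f i, i) | i. i \<in> V \<and> f i \<noteq> i}"
  proof (rule set_eqI)
    fix e :: "'a \<times> 'a"
    obtain a b where e: "e = (a, b)" by (cases e)
    show "e \<in> {e \<in> parcs ?G. \<exists>p v. pre_digraph.apath (with_proj ?G) r p v \<and> e \<in> set p}
      \<longleftrightarrow> e \<in> {(f i, i) | i. i \<in> V \<and> f i \<noteq> i}"
      unfolding e mem_Collect_eq prod.inject iff by blast
  qed
  then show ?thesis by (simp add: orient_away_def tree_digraph_def)
qed

text \<open>
  In a connected graph a spanning tree is found by giving each vertex a parent that is closer to
  the root \<open>r\<close>.
\<close>

lemma parent_map_exists:
  assumes "pair_graph G" "connected (with_proj G)" "r \<in> pverts G"
  shows "\<exists>f. tree_map (pverts G) f \<and> f r = r \<and>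
    parcs (underlying_graph (pverts G) f) \<subseteq> parcs G"
proof -
  interpret G: pair_graph G by (rule assms(1))
  let ?V = "pverts G"
  have walk: "\<exists>k. (r, v) \<in> parcs G ^^ k" if "v \<in> ?V" for v
  proof -
    have "strongly_connected (with_proj G)"
      by (rule G.symmetric_connected_imp_strongly_connected[OF G.sym_arcs assms(2)])
    then have "r \<rightarrow>\<^sup>*\<^bsub>with_proj G\<^esub> v" using assms(3) that by (simp add: strongly_connected_def)
    then have "(r, v) \<in> (parcs G)\<^sup>*" using reachable_rtranclI[of "with_proj G"] by simp
    then show ?thesis by (simp add: rtrancl_power)
  qed
  define d where "d v = (LEAST k. (r, v) \<in> parcs G ^^ k)" for v
  have closer: "\<exists>u. (u, v) \<in> parcs G \<and> d u < d v" if v: "v \<in> ?V" "v \<noteq> r" for v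
  proof -
    have dv: "(r, v) \<in> parcs G ^^ d v" unfolding d_def using walk[OF v(1)] by (rule LeastI_ex)
    then obtain k where k: "d v = Suc k" using v(2) by (cases "d v") auto
    then obtain u where u: "(r, u) \<in> parcs G ^^ k" "(u, v) \<in> parcs G" using dv by auto
    have "d u \<le> k" unfolding d_def using u(1) by (rule Least_le)
    then show ?thesis using u(2) k by auto
  qed
  define f where "f v = (if v \<notin> ?V then undefined else if v = r then r
      else SOME u. (u, v) \<in> parcs G \<and> d u < d v)" for v
  have f: "(f v, v) \<in> parcs G" "d (f v) < d v" if "v \<in> ?V" "v \<noteq> r" for v
    using someI_ex[OF closer[OF that]] that by (simp_all add: f_def)
  have fr: "f r = r" using assms(3) by (simp add: f_def)
  have fV: "f \<in> ?V \<rightarrow>\<^sub>E ?V"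
  proof
    fix v assume "v \<in> ?V"
    then show "f v \<in> ?V" using f(1) fr G.in_arcsD1 by (cases "v = r") auto
  qed (simp add: f_def)
  have fix_iff: "f v = v \<longleftrightarrow> v = r" if "v \<in> ?V" for v
    using f(2)[OF that] fr by (cases "v = r") auto
  have "\<exists>k. f ((f ^^ k) v) = (f ^^ k) v" if "v \<in> ?V" for v
    using that
  proof (induction "d v" arbitrary: v rule: less_induct)
    case less
    show ?case
    proof (cases "v = r")
      case True
      then have "f ((f ^^ 0) v) = (f ^^ 0) v" using fr by simp
      then show ?thesis by blast
    next
      case False
      then obtain k where "f ((f ^^ k) (f v)) = (f ^^ k) (f v)"
        using less f(2) fV by blast
      then have "f ((f ^^ Suc k) v) = (f ^^ Suc k) v" by (simp add: funpow_swap1)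
      then show ?thesis by blast
    qed
  qed
  moreover have "roots ?V f = {r}" using fix_iff assms(3) by (auto simp: roots_def)
  ultimately have "tree_map ?V f" using fV by (simp add: tree_map_def forest_map_def)
  moreover have "parcs (underlying_graph ?V f) \<subseteq> parcs G"
  proof
    fix e assume "e \<in> parcs (underlying_graph ?V f)"
    then obtain a b where e: "e = (a, b)" "a \<in> ?V" "b \<in> ?V" "a \<noteq> b" "a = f b \<or> b = f a"
      using parcs_underlying_graph[OF fV] by (metis surj_pair)
    then show "e \<in> parcs G"
      using f(1) fr G.arcs_symmetric by metis
  qed
  ultimately show ?thesis using fr by blast
qed

text \<open>
  An edge outside the spanning tree would close a cycle with the path between its endpoints in the
  spanning tree. This path has at least two edges, so the cycle has length at least three.
\<close>

lemma undirected_tree_is_underlying_graph: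
  assumes "undirected_tree G" "r \<in> pverts G"
  shows "\<exists>f. tree_map (pverts G) f \<and> f r = r \<and> G = underlying_graph (pverts G) f"
proof -
  have G: "pair_graph G" and conn: "connected (with_proj G)"
    and acyclic: "\<And>p. pre_digraph.cycle (with_proj G) p \<Longrightarrow> length p < 3"
    using assms(1) by (auto simp: undirected_tree_def not_le)
  interpret G: pair_graph G by (rule G)
  let ?V = "pverts G"
  have fin: "finite ?V" by (rule G.pair_finite_verts)
  obtain f where f: "tree_map ?V f" "f r = r" "parcs (underlying_graph ?V f) \<subseteq> parcs G"
    using parent_map_exists[OF G conn assms(2)] by blast
  have fV: "f \<in> ?V \<rightarrow>\<^sub>E ?V" using f(1) by (simp add: tree_map_def forest_map_def)
  interpret T: pair_graph "underlying_graph ?V f"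
    by (rule pair_graph_underlying_graph[OF fin fV])
  have "(a, b) \<in> parcs (underlying_graph ?V f)" if ab: "(a, b) \<in> parcs G" for a b
  proof (rule ccontr)
    assume no: "(a, b) \<notin> parcs (underlying_graph ?V f)"
    have abV: "a \<in> ?V" "b \<in> ?V" "a \<noteq> b" using ab G.wellformed' G.no_loops' by auto
    have "a \<rightarrow>\<^sup>*\<^bsub>with_proj (underlying_graph ?V f)\<^esub> b"
      by (rule reachable_underlying_graph[OF fin f(1) abV(1,2)])
    then obtain p where "pre_digraph.apath (with_proj (underlying_graph ?V f)) a p b"
      using T.reachable_apath by blast
    then have p: "set p \<subseteq> parcs (underlying_graph ?V f)" "pcas a p b" "distinct (a # map snd p)"
      by (auto simp: apath_with_proj_iff)
    have "p \<noteq> []" using p(2) abV(3) by auto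
    moreover have "length p \<noteq> 1"
    proof
      assume "length p = 1"
      then obtain e where "p = [e]" by (auto simp: length_Suc_conv)
      then show False using p no by (cases e) auto
    qed
    ultimately have "2 \<le> length p" by (cases p; cases "tl p") auto
    moreover have "pre_digraph.cycle (with_proj G) (p @ [(b, a)])"
      unfolding cycle_with_proj_iff
    proof (intro exI[of _ a] conjI)
      show "a \<in> ?V" by (rule abV(1))
      show "set (p @ [(b, a)]) \<subseteq> parcs G" using p(1) f(3) G.arcs_symmetric[OF ab] by auto
      show "pcas a (p @ [(b, a)]) a" using p(2) unfolding pcas_append by (intro exI[of _ b]) simp
      show "distinct (map snd (p @ [(b, a)]))" using p(3) by auto
    qed simp
    ultimately show False using acyclic by fastforce
  qed
  then have "parcs G = parcs (underlying_graph ?V f)" using f(3) by auto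
  then have "G = underlying_graph ?V f" by (simp add: pair_pre_digraph.equality)
  then show ?thesis using f by blast
qed

theorem source_trees_eq:
  "source_trees n = tree_digraph {1..n} ` {f. tree_map {1..n} f}"
proof (intro set_eqI iffI)
  fix D assume "D \<in> source_trees n"
  then obtain r T where D: "D = orient_away r T" "undirected_tree T" "pverts T = {1..n}" "r \<in> {1..n}"
    unfolding source_trees_def by blast
  then obtain f where f: "tree_map {1..n} f" "f r = r" "T = underlying_graph {1..n} f"
    using undirected_tree_is_underlying_graph[of T r] by auto
  then have "D = tree_digraph {1..n} f"
    using orient_away_underlying_graph[OF _ f(1,2) D(4)] D(1) by simp
  then show "D \<in> tree_digraph {1..n} ` {f. tree_map {1..n} f}" using f(1) by blast
next
  fix D assume "D \<in> tree_digraph {1..n} ` {f. tree_map {1..n} f}"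
  then obtain f where D: "D = tree_digraph {1..n} f" and f: "tree_map {1..n} f" by blast
  obtain r where r: "r \<in> {1..n}" "f r = r" using tree_map_has_root[OF f] by blast
  have "D = orient_away r (underlying_graph {1..n} f)"
    using orient_away_underlying_graph[OF _ f r(2,1)] D by simp
  moreover have "undirected_tree (underlying_graph {1..n} f)"
    by (rule undirected_tree_underlying_graph[OF _ f]) simp
  ultimately show "D \<in> source_trees n"
    unfolding source_trees_def using r(1)
    by (intro CollectI exI[of _ r] exI[of _ "underlying_graph {1..n} f"] conjI) simp_all
qed

lemma inj_on_tree_digraph: "inj_on (tree_digraph V) {f. tree_map V f}"
proof (rule inj_onI)
  fix f g assume fg: "f \<in> {f. tree_map V f}" "g \<in> {f. tree_map V f}" "tree_digraph V f = tree_digraph V g"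
  have arcs: "{(f i, i) | i. i \<in> V \<and> f i \<noteq> i} = {(g i, i) | i. i \<in> V \<and> g i \<noteq> i}"
    using fg(3) by (simp add: tree_digraph_def)
  have "(a, i) \<in> {(f i, i) | i. i \<in> V \<and> f i \<noteq> i} \<longleftrightarrow> (a, i) \<in> {(g i, i) | i. i \<in> V \<and> g i \<noteq> i}" for a i
    unfolding arcs ..
  then have *: "(i \<in> V \<and> a = f i \<and> f i \<noteq> i) \<longleftrightarrow> (i \<in> V \<and> a = g i \<and> g i \<noteq> i)" for a i by auto
  show "f = g"
  proof (rule PiE_ext[of f V "\<lambda>_. V" g])
    fix i assume "i \<in> V"
    then show "f i = g i" using * [of i "f i"] * [of i "g i"] by metis
  qed (use fg in \<open>auto simp: tree_map_def forest_map_def\<close>)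
qed

section \<open>Summing over preference lists\<close>

text \<open>
  Exchanging the two summations reduces the comparison of both families to a comparison for each
  preference list.
\<close>

lemma sum_num_parking_functions:
  assumes "finite A" "A \<subseteq> {1..n} \<rightarrow>\<^sub>E {1..n}"
  shows "(\<Sum>f\<in>A. num_parking_functions (inverse_mapping_digraph n f) n)
    = (\<Sum>s | set s \<subseteq> {1..n} \<and> length s = n.
         card {f \<in> A. \<exists>\<phi>. is_flow {1..n} f (count_list s) (\<lambda>_. 1) \<phi>})"
proof -
  let ?V = "{1..n}"
  let ?S = "{s. set s \<subseteq> ?V \<and> length s = n}"
  let ?R = "\<lambda>f s. \<exists>\<phi>. is_flow ?V f (count_list s) (\<lambda>_. 1) \<phi>"
  have parks: "parking_function (inverse_mapping_digraph n f) s \<longleftrightarrow> ?R f s" if "s \<in> ?S" for f s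
    using that by (intro parking_function_iff_flow) (simp_all add: inverse_mapping_digraph_def)
  have "{s. length s = n \<and> parking_function (inverse_mapping_digraph n f) s} = {s \<in> ?S. ?R f s}" for f
  proof (rule set_eqI)
    fix s
    have "parking_function (inverse_mapping_digraph n f) s \<Longrightarrow> set s \<subseteq> ?V"
      by (simp add: parking_function_def inverse_mapping_digraph_def)
    then show "s \<in> {s. length s = n \<and> parking_function (inverse_mapping_digraph n f) s}
        \<longleftrightarrow> s \<in> {s \<in> ?S. ?R f s}"
      using parks[of s f] unfolding mem_Collect_eq by blast
  qed
  then have "(\<Sum>f\<in>A. num_parking_functions (inverse_mapping_digraph n f) n)
      = (\<Sum>f\<in>A. card {s \<in> ?S. ?R f s})"
    by (simp only: num_parking_functions_def)
  also have "\<dots> = (\<Sum>s\<in>?S. card {f \<in> A. ?R f s})"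
    by (rule sum_multicount_gen) (use assms(1) finite_lists_length_eq[of ?V n] in simp_all)
  finally show ?thesis .
qed

lemma inj_on_inverse_mapping_digraph:
  "inj_on (inverse_mapping_digraph n) ({1..n} \<rightarrow>\<^sub>E {1..n})"
proof (rule inj_onI)
  fix f g
  assume fg: "f \<in> {1..n} \<rightarrow>\<^sub>E {1..n}" "g \<in> {1..n} \<rightarrow>\<^sub>E {1..n}"
    "inverse_mapping_digraph n f = inverse_mapping_digraph n g"
  have arcs: "{(f i, i) | i. i \<in> {1..n}} = {(g i, i) | i. i \<in> {1..n}}"
    using fg(3) by (simp add: inverse_mapping_digraph_def)
  show "f = g"
  proof (rule PiE_ext[OF fg(1,2)])
    fix i assume "i \<in> {1..n}"
    then have "(f i, i) \<in> {(g i, i) | i. i \<in> {1..n}}" unfolding arcs[symmetric] by blast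
    then show "f i = g i" by blast
  qed
qed

lemma num_parking_functions_tree_digraph:
  "num_parking_functions (tree_digraph {1..n} f) m
     = num_parking_functions (inverse_mapping_digraph n f) m"
proof (rule num_parking_functions_loops)
  show "parcs (tree_digraph {1..n} f) - Id = parcs (inverse_mapping_digraph n f) - Id"
    by (auto simp: tree_digraph_def inverse_mapping_digraph_def)
qed (simp add: tree_digraph_def inverse_mapping_digraph_def)

theorem theorem3:
  fixes n :: nat
  assumes "n \<ge> 1"
  shows "n * F_tilde n n = M_tilde n n"
proof -
  let ?V = "{1..n}"
  let ?S = "{s. set s \<subseteq> ?V \<and> length s = n}"
  let ?R = "\<lambda>f s. \<exists>\<phi>. is_flow ?V f (count_list s) (\<lambda>_. 1) \<phi>"
  have trees: "{f. tree_map ?V f} \<subseteq> ?V \<rightarrow>\<^sub>E ?V" "finite {f. tree_map ?V f}"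
  proof -
    show *: "{f. tree_map ?V f} \<subseteq> ?V \<rightarrow>\<^sub>E ?V"
      by (simp add: subset_iff tree_map_def forest_map_def)
    show "finite {f. tree_map ?V f}" by (rule finite_subset[OF *]) (simp add: finite_PiE)
  qed
  have "F_tilde n n = (\<Sum>f | tree_map ?V f. num_parking_functions (inverse_mapping_digraph n f) n)"
    unfolding F_tilde_def source_trees_eq
    by (simp only: sum.reindex[OF inj_on_tree_digraph] o_def num_parking_functions_tree_digraph)
  also have "\<dots> = (\<Sum>s\<in>?S. card {f \<in> {f. tree_map ?V f}. ?R f s})"
    by (rule sum_num_parking_functions[OF trees(2,1)])
  finally have "n * F_tilde n n = (\<Sum>s\<in>?S. n * card {f. tree_map ?V f \<and> ?R f s})"
    by (simp add: sum_distrib_left)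
  also have "\<dots> = (\<Sum>s\<in>?S. card {f \<in> ?V \<rightarrow>\<^sub>E ?V. ?R f s})"
    using card_tree_maps_with_flow[of ?V] assms by (intro sum.cong[OF refl]) simp
  also have "\<dots> = (\<Sum>f\<in>?V \<rightarrow>\<^sub>E ?V. num_parking_functions (inverse_mapping_digraph n f) n)"
    by (rule sum_num_parking_functions[symmetric]) (simp_all add: finite_PiE)
  also have "\<dots> = M_tilde n n"
    unfolding M_tilde_def inverse_mapping_digraphs_def
    by (simp only: sum.reindex[OF inj_on_inverse_mapping_digraph] o_def)
  finally show ?thesis .
qed

end
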